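(* Let $a\in\mathbb{C}\setminus\{0,-1,-2,\ldots\}$, and let $z,s\in\mathbb{C}$ be such that the series defining the functions $H_k(z,s,a)$ converge absolutely (that is, $|z|<1$, or $|z|=1$ and $\operatorname{Re}(s)>3$). Let $$G(y;z,s,a)=\sum_{k=0}^{\infty}H_k(z,s,a)y^k.$$ For $|y|<\frac14$, $$G(y;z,s,a)=\frac{\frac32D^2\Phi(z,s,a)}{1-4y}+\frac{\frac32D\Phi(z,s,a)}{1-2y}+\frac{\Phi(z,s,a)}{1-y}.$$ This may also be written as $$G(y;z,s,a)=\frac{\frac32\left[\Phi(z,s-2,a)-2a\Phi(z,s-1,a)+a^2\Phi(z,s,a)\right]}{1-4y}+\frac{\frac32\left[\Phi(z,s-1,a)-a\Phi(z,s,a)\right]}{1-2y}+\frac{\Phi(z,s,a)}{1-y}.$$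
   Context: The $k$-augmented centered triangular numbers are given by $A(r+1,k)=\frac32 4^k r^2+\frac32 2^k r+1$ for integers $r,k\ge0$. Complex powers are principal: $(r+a)^{-s}=\exp\{-s\operatorname{Log}(r+a)\}$, $-\pi<\operatorname{Arg}\le\pi$. The Hurwitz--Lerch transcendent is $\Phi(z,s,a)=\sum_{r=0}^{\infty}\frac{z^r}{(r+a)^s}$, and $H_k(z,s,a)=\sum_{r=0}^{\infty}\frac{A(r+1,k)z^r}{(r+a)^s}$. $D=z\frac{d}{dz}$ is the Euler operator; for $|z|<1$, $D^j\Phi(z,s,a)$ is the result of applying $D$ $j$ times to $\Phi$ in the variable $z$, and at points $|z|=1$ the symbol $D^j\Phi(z,s,a)$ means the termwise-differentiated series $\sum_{r\ge0} r^j z^r/(r+a)^s$ (absolutely convergent there). *)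

theory Defs
  imports "HOL-Analysis.Analysis"
begin

text \<open>
  The \<open>k\<close>-augmented centered triangular numbers. The closed form is given in terms of
  \<open>r = n - 1\<close>, so only the values at \<open>n \<ge> 1\<close> are meaningful.
\<close>
definition aug_centered_tri :: "nat \<Rightarrow> nat \<Rightarrow> real" where
  "aug_centered_tri n k =
     3 / 2 * 4 ^ k * (real n - 1)\<^sup>2 + 3 / 2 * 2 ^ k * (real n - 1) + 1"

text \<open>
  The complex \<^const>\<open>powr\<close> is the principal power: \<open>w powr (-s) = exp (- s * Ln w)\<close> for
  \<open>w \<noteq> 0\<close>, with \<open>- pi < Im (Ln w) \<le> pi\<close>.
\<close>
definition Lerch_Phi :: "complex \<Rightarrow> complex \<Rightarrow> complex \<Rightarrow> complex" where
  "Lerch_Phi z s a = (\<Sum>r. z ^ r * (of_nat r + a) powr (- s))"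

definition H_term :: "nat \<Rightarrow> complex \<Rightarrow> complex \<Rightarrow> complex \<Rightarrow> nat \<Rightarrow> complex" where
  "H_term k z s a r =
     of_real (aug_centered_tri (r + 1) k) * z ^ r * (of_nat r + a) powr (- s)"

definition H :: "nat \<Rightarrow> complex \<Rightarrow> complex \<Rightarrow> complex \<Rightarrow> complex" where
  "H k z s a = (\<Sum>r. H_term k z s a r)"

definition G :: "complex \<Rightarrow> complex \<Rightarrow> complex \<Rightarrow> complex \<Rightarrow> complex" where
  "G y z s a = (\<Sum>k. H k z s a * y ^ k)"

definition euler_op :: "(complex \<Rightarrow> complex) \<Rightarrow> complex \<Rightarrow> complex" where
  "euler_op f = (\<lambda>z. z * deriv f z)"

text \<open>
  \<open>D\<^sup>j \<Phi>(z, s, a)\<close>: iterated Euler operator in \<open>z\<close> inside the unit disc; on the unit circle,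
  by convention, the termwise differentiated series. Points with \<open>norm z > 1\<close> are irrelevant.
\<close>
definition D_Phi :: "nat \<Rightarrow> complex \<Rightarrow> complex \<Rightarrow> complex \<Rightarrow> complex" where
  "D_Phi j z s a =
     (if norm z < 1 then (euler_op ^^ j) (\<lambda>w. Lerch_Phi w s a) z
      else (\<Sum>r. of_nat r ^ j * z ^ r * (of_nat r + a) powr (- s)))"

end

theory Submission
  imports Defs "HOL-Real_Asymp.Real_Asymp"
begin

text \<open>
  Expanded in powers of \<open>r\<close>, the \<open>r\<close>-th term of the series for \<open>H\<close> is a combination of
  the three terms \<open>r\<^sup>j z\<^sup>r (r + a)\<^sup>-\<^sup>s\<close>, \<open>j = 0, 1, 2\<close>, and its only dependence on \<open>k\<close> is through
  the weights \<open>1\<close>, \<open>2\<^sup>k\<close> and \<open>4\<^sup>k\<close>. Writing \<open>S\<^sub>j\<close> for the sums of those three series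
  (\<open>Lerch_moment\<close> below), this gives
  \<open>H\<^sub>k = 3/2 4\<^sup>k S\<^sub>2 + 3/2 2\<^sup>k S\<^sub>1 + S\<^sub>0\<close>, so \<open>G\<close> is a sum of three geometric series with
  ratios \<open>4y\<close>, \<open>2y\<close> and \<open>y\<close>. The two closed forms are two evaluations of \<open>S\<^sub>1\<close> and \<open>S\<^sub>2\<close>: inside
  the disc a power series may be differentiated termwise, so that \<open>S\<^sub>j = D\<^sup>j \<Phi>\<close>
  (\<open>D_Phi_eq_Lerch_moment\<close>); and expanding \<open>r\<^sup>j = ((r + a) - a)\<^sup>j\<close> lowers the exponent \<open>s\<close> of
  \<open>r + a\<close>, which never vanishes (\<open>Lerch_moment_Suc\<close>).

  The domain of absolute convergence comes from the growth of the terms. The argument of \<open>r + a\<close>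
  is bounded, so the modulus of \<open>(r + a)\<^sup>-\<^sup>s\<close> is of the exact order of \<open>r\<close> to the power \<open>-Re s\<close>.
  As \<open>A (r + 1) k\<close> is of exact order \<open>r\<^sup>2\<close>, the series for \<open>H\<close> converges absolutely exactly when
  the real series with terms \<open>r powr (2 - Re s) * (norm z) ^ r\<close> converges
  (\<open>summable_powr_times_power_iff\<close>).
\<close>

section \<open>Growth of the terms and absolute convergence\<close>

lemma summable_bigtheta_iff:
  fixes f g :: "nat \<Rightarrow> real"
  assumes "f \<in> \<Theta>(g)" "\<And>n. 0 \<le> f n" "\<And>n. 0 \<le> g n"
  shows "summable f \<longleftrightarrow> summable g"
  using summable_comparison_test_bigo[of g f] summable_comparison_test_bigo[of f g] assms
  by (auto simp: bigtheta_def bigomega_iff_bigo)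

lemma summable_powr_times_power_iff:
  fixes p x :: real
  assumes "0 \<le> x"
  shows "summable (\<lambda>r. real r powr p * x ^ r) \<longleftrightarrow> x < 1 \<or> x = 1 \<and> p < - 1"
proof -
  consider "x = 0" | "0 < x" "x < 1" | "x = 1" | "1 < x"
    using assms by linarith
  then show ?thesis
  proof cases
    case 1
    then have "summable (\<lambda>r. real r powr p * x ^ r)"
      by (intro summable_finite[of "{0}"]) auto
    with 1 show ?thesis by simp
  next
    case 2
    \<comment> \<open>Splitting \<open>x = q * q\<close> leaves one geometric factor to absorb the power of \<open>r\<close> and one
      to sum.\<close>
    define q where "q = sqrt x"
    have q: "0 < q" "q < 1" "x = q * q"
      using 2 by (auto simp: q_def)
    have "(\<lambda>r::nat. real r powr p * q ^ r) \<in> O(\<lambda>_. 1)"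
      using q by real_asymp
    then have "(\<lambda>r::nat. real r powr p * q ^ r * q ^ r) \<in> O(\<lambda>r. 1 * q ^ r)"
      by (intro landau_o.big.mult) auto
    then have "(\<lambda>r::nat. real r powr p * x ^ r) \<in> O(\<lambda>r. q ^ r)"
      by (simp add: q(3) power_mult_distrib mult.assoc)
    moreover have "summable (\<lambda>r. norm (q ^ r))"
      using q by (simp add: norm_power summable_geometric)
    ultimately show ?thesis
      using summable_comparison_test_bigo 2 by blast
  next
    case 3
    then show ?thesis by (simp add: summable_real_powr_iff)
  next
    case 4
    then have "filterlim (\<lambda>r::nat. real r powr p * x ^ r) at_top at_top"
      by real_asymp
    then have "\<not> summable (\<lambda>r. real r powr p * x ^ r)"
      using summable_LIMSEQ_zero not_tendsto_and_filterlim_at_infinity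
        filterlim_at_top_imp_at_infinity trivial_limit_sequentially by blast
    with 4 show ?thesis by simp
  qed
qed

lemma norm_of_nat_plus_bigtheta:
  fixes a :: complex
  shows "(\<lambda>r. norm (of_nat r + a)) \<in> \<Theta>(\<lambda>r. real r)"
proof (rule bigthetaI'[of "1/2" 2])
  show "eventually (\<lambda>r. 1 / 2 * norm (real r) \<le> norm (norm (of_nat r + a)) \<and>
          norm (norm (of_nat r + a)) \<le> 2 * norm (real r)) sequentially"
    using eventually_ge_at_top[of "nat \<lceil>2 * norm a\<rceil>"]
  proof eventually_elim
    case (elim r)
    then have "2 * norm a \<le> real r" by linarith
    moreover have "real r - norm a \<le> norm (of_nat r + a)"
      using norm_diff_ineq[of "of_nat r :: complex" a] by simp
    moreover have "norm (of_nat r + a) \<le> real r + norm a"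
      using norm_triangle_ineq[of "of_nat r :: complex" a] by simp
    ultimately show ?case by simp
  qed
qed auto

text \<open>
  The modulus of a complex power differs from the power of the modulus by the factor
  \<open>exp (- Im w * Arg (r + a))\<close>; the principal argument is bounded by \<open>pi\<close>, so this factor lies
  between two positive constants.
\<close>
lemma norm_of_nat_plus_powr_bigtheta:
  fixes a w :: complex
  shows "(\<lambda>r. norm ((of_nat r + a) powr w)) \<in> \<Theta>(\<lambda>r. real r powr Re w)"
proof -
  have "(\<lambda>r. exp (- Im w * Arg (of_nat r + a))) \<in> \<Theta>(\<lambda>_. 1 :: real)"
  proof (rule bigthetaI'[of "exp (- (\<bar>Im w\<bar> * pi))" "exp (\<bar>Im w\<bar> * pi)"])
    have "\<bar>Im w * Arg (of_nat r + a)\<bar> \<le> \<bar>Im w\<bar> * pi" for r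
      using mpi_less_Arg[of "of_nat r + a"] Arg_le_pi[of "of_nat r + a"]
      by (auto simp: abs_mult intro!: mult_left_mono)
    then have "- (\<bar>Im w\<bar> * pi) \<le> - Im w * Arg (of_nat r + a) \<and>
               - Im w * Arg (of_nat r + a) \<le> \<bar>Im w\<bar> * pi" for r
      by (smt (verit) mult_minus_left)
    then show "\<forall>\<^sub>F r in sequentially.
        exp (- (\<bar>Im w\<bar> * pi)) * norm (1 :: real) \<le> norm (exp (- Im w * Arg (of_nat r + a))) \<and>
        norm (exp (- Im w * Arg (of_nat r + a))) \<le> exp (\<bar>Im w\<bar> * pi) * norm (1 :: real)"
      by (intro always_eventually allI) simp
  qed auto
  moreover have "(\<lambda>r. norm (of_nat r + a) powr Re w) \<in> \<Theta>(\<lambda>r. real r powr Re w)"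
    using bigtheta_powr[OF norm_of_nat_plus_bigtheta[of a], of "Re w"] by simp
  ultimately have "(\<lambda>r. norm (of_nat r + a) powr Re w * exp (- Im w * Arg (of_nat r + a)))
      \<in> \<Theta>(\<lambda>r. real r powr Re w * 1)"
    by (intro landau_theta.mult)
  then show ?thesis
    by (simp add: norm_powr_complex)
qed

definition Lerch_moment_term :: "nat \<Rightarrow> complex \<Rightarrow> complex \<Rightarrow> complex \<Rightarrow> nat \<Rightarrow> complex" where
  "Lerch_moment_term j z s a r = of_nat r ^ j * z ^ r * (of_nat r + a) powr (- s)"

definition Lerch_moment :: "nat \<Rightarrow> complex \<Rightarrow> complex \<Rightarrow> complex \<Rightarrow> complex" where
  "Lerch_moment j z s a = (\<Sum>r. Lerch_moment_term j z s a r)"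

lemma Lerch_Phi_eq_Lerch_moment: "Lerch_Phi z s a = Lerch_moment 0 z s a"
  by (simp add: Lerch_Phi_def Lerch_moment_def Lerch_moment_term_def)

lemma norm_Lerch_moment_term_bigtheta:
  "(\<lambda>r. norm (Lerch_moment_term j z s a r))
     \<in> \<Theta>(\<lambda>r. real r powr (real j - Re s) * norm z ^ r)"
proof -
  have "(\<lambda>r. real r ^ j * norm z ^ r * norm ((of_nat r + a) powr (- s)))
      \<in> \<Theta>(\<lambda>r. real r ^ j * norm z ^ r * real r powr (- Re s))"
    using norm_of_nat_plus_powr_bigtheta[of a "- s"] by (intro landau_theta.mult) auto
  also have "(\<lambda>r. real r ^ j * norm z ^ r * real r powr (- Re s))
      \<in> \<Theta>(\<lambda>r. real r powr (real j - Re s) * norm z ^ r)"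
    by (intro bigthetaI_cong eventually_mono[OF eventually_gt_at_top[of 0]])
       (simp add: powr_diff powr_minus powr_realpow field_simps)
  finally show ?thesis
    by (simp add: Lerch_moment_term_def norm_mult norm_power)
qed

lemma abs_summable_Lerch_moment_term_iff:
  "summable (\<lambda>r. norm (Lerch_moment_term j z s a r)) \<longleftrightarrow>
     norm z < 1 \<or> norm z = 1 \<and> Re s > real j + 1"
proof -
  have "summable (\<lambda>r. norm (Lerch_moment_term j z s a r)) \<longleftrightarrow>
      summable (\<lambda>r. real r powr (real j - Re s) * norm z ^ r)"
    by (rule summable_bigtheta_iff[OF norm_Lerch_moment_term_bigtheta]) auto
  then show ?thesis
    by (auto simp: summable_powr_times_power_iff)
qed

lemma Lerch_moment_sums:
  assumes "norm z < 1 \<or> norm z = 1 \<and> Re s > real j + 1"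
  shows "Lerch_moment_term j z s a sums Lerch_moment j z s a"
  using assms abs_summable_Lerch_moment_term_iff summable_norm_cancel summable_sums
  unfolding Lerch_moment_def by blast

text \<open>
  The quadratic coefficient of \<open>A (r + 1) k\<close> never vanishes, so for every single \<open>k\<close> the terms of
  \<open>H k\<close> are as large as those of the second moment.
\<close>
lemma abs_summable_H_term_iff:
  "summable (\<lambda>r. norm (H_term k z s a r)) \<longleftrightarrow> norm z < 1 \<or> norm z = 1 \<and> Re s > 3"
proof -
  have "(\<lambda>r. \<bar>aug_centered_tri (r + 1) k\<bar> * norm (z ^ r * (of_nat r + a) powr (- s)))
      \<in> \<Theta>(\<lambda>r. real r ^ 2 * norm (z ^ r * (of_nat r + a) powr (- s)))"
  proof (intro landau_theta.mult)
    show "(\<lambda>r. \<bar>aug_centered_tri (r + 1) k\<bar>) \<in> \<Theta>(\<lambda>r. real r ^ 2)"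
      unfolding aug_centered_tri_def by real_asymp
  qed auto
  then have "(\<lambda>r. norm (H_term k z s a r)) \<in> \<Theta>(\<lambda>r. norm (Lerch_moment_term 2 z s a r))"
    by (simp add: H_term_def Lerch_moment_term_def norm_mult norm_power mult.assoc)
  then have "summable (\<lambda>r. norm (H_term k z s a r)) \<longleftrightarrow>
      summable (\<lambda>r. norm (Lerch_moment_term 2 z s a r))"
    by (rule summable_bigtheta_iff) auto
  then show ?thesis
    by (simp add: abs_summable_Lerch_moment_term_iff)
qed

section \<open>Two evaluations of the moments\<close>

lemma euler_op_power_series:
  fixes c :: "nat \<Rightarrow> complex"
  assumes summable: "\<And>w. norm w < 1 \<Longrightarrow> summable (\<lambda>r. c r * w ^ r)"
    and f: "\<And>w. norm w < 1 \<Longrightarrow> f w = (\<Sum>r. c r * w ^ r)"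
    and z: "norm z < 1"
  shows "(\<lambda>r. of_nat r * c r * z ^ r) sums euler_op f z"
proof -
  obtain \<rho> where \<rho>: "norm z < \<rho>" "\<rho> < 1"
    using z dense by blast
  then have K: "norm z < norm (of_real \<rho> :: complex)" "norm (of_real \<rho> :: complex) < 1"
    using norm_ge_zero[of z] by (auto simp del: norm_ge_zero)
  have "((\<lambda>w. \<Sum>r. c r * w ^ r) has_field_derivative (\<Sum>r. diffs c r * z ^ r)) (at z)"
    using K summable by (intro termdiffs_strong[of c "of_real \<rho>"]) auto
  then have "(f has_field_derivative (\<Sum>r. diffs c r * z ^ r)) (at z)"
    by (rule has_field_derivative_transform_within_open[of _ _ _ "ball 0 1"])
       (use z f in auto)
  then have deriv: "deriv f z = (\<Sum>r. diffs c r * z ^ r)"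
    by (rule DERIV_imp_deriv)
  have "summable (\<lambda>r. diffs c r * z ^ r)"
    using z summable by (intro termdiff_converges[of z 1]) auto
  then have "(\<lambda>r. z * (of_nat r * c r * z ^ (r - Suc 0))) sums (z * deriv f z)"
    unfolding deriv by (intro sums_mult diffs_equiv)
  moreover have "z * (of_nat r * c r * z ^ (r - Suc 0)) = of_nat r * c r * z ^ r" for r
    by (cases r) auto
  ultimately show ?thesis
    by (simp add: euler_op_def)
qed

lemma euler_op_funpow_Lerch_Phi:
  assumes "norm z < 1"
  shows "(euler_op ^^ j) (\<lambda>w. Lerch_Phi w s a) z = Lerch_moment j z s a"
  using assms
proof (induction j arbitrary: z)
  case 0
  then show ?case by (simp add: Lerch_Phi_eq_Lerch_moment)
next
  case (Suc j)
  define c where "c = (\<lambda>r. of_nat r ^ j * (of_nat r + a) powr (- s))"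
  have moment: "Lerch_moment_term j w s a = (\<lambda>r. c r * w ^ r)" for w
    by (auto simp: Lerch_moment_term_def c_def mult_ac)
  have "(\<lambda>r. of_nat r * c r * z ^ r) sums euler_op ((euler_op ^^ j) (\<lambda>w. Lerch_Phi w s a)) z"
  proof (rule euler_op_power_series)
    fix w :: complex
    assume w: "norm w < 1"
    show "summable (\<lambda>r. c r * w ^ r)"
      using Lerch_moment_sums[of w j s a] w by (auto simp: moment sums_iff)
    show "(euler_op ^^ j) (\<lambda>w. Lerch_Phi w s a) w = (\<Sum>r. c r * w ^ r)"
      using Suc.IH[OF w] by (simp add: Lerch_moment_def moment)
  qed (rule Suc.prems)
  moreover have "(\<lambda>r. of_nat r * c r * z ^ r) = Lerch_moment_term (Suc j) z s a"
    by (auto simp: Lerch_moment_term_def c_def mult_ac)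
  ultimately show ?case
    by (simp add: Lerch_moment_def sums_iff)
qed

lemma D_Phi_eq_Lerch_moment: "D_Phi j z s a = Lerch_moment j z s a"
  by (simp add: D_Phi_def euler_op_funpow_Lerch_Phi)
     (simp add: Lerch_moment_def Lerch_moment_term_def)

text \<open>
  One factor \<open>r\<close> is written as \<open>(r + a) - a\<close> and the factor \<open>r + a\<close> is absorbed into the power,
  which requires \<open>r + a \<noteq> 0\<close>.
\<close>
lemma Lerch_moment_Suc:
  assumes a: "a \<notin> \<int>\<^sub>\<le>\<^sub>0"
    and conv: "norm z < 1 \<or> norm z = 1 \<and> Re s > real j + 2"
  shows "Lerch_moment (Suc j) z s a = Lerch_moment j z (s - 1) a - a * Lerch_moment j z s a"
proof -
  have "Lerch_moment_term (Suc j) z s a r =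
      Lerch_moment_term j z (s - 1) a r - a * Lerch_moment_term j z s a r" for r
  proof -
    have "of_nat r + a \<noteq> 0"
    proof
      assume "of_nat r + a = 0"
      then have "a = - of_nat r" by (simp add: add_eq_0_iff)
      with a show False by simp
    qed
    then have "(of_nat r + a) powr (1 - s) = (of_nat r + a) * (of_nat r + a) powr (- s)"
      using powr_add[of "of_nat r + a" 1 "- s"] by (simp add: powr_to_1)
    then show ?thesis
      by (simp add: Lerch_moment_term_def algebra_simps)
  qed
  moreover have "(\<lambda>r. Lerch_moment_term j z (s - 1) a r - a * Lerch_moment_term j z s a r)
      sums (Lerch_moment j z (s - 1) a - a * Lerch_moment j z s a)"
    using conv by (intro sums_diff sums_mult Lerch_moment_sums) auto
  ultimately show ?thesis
    by (simp add: Lerch_moment_def sums_iff)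
qed

section \<open>The generating function\<close>

lemma H_eq_Lerch_moments:
  assumes "norm z < 1 \<or> norm z = 1 \<and> Re s > 3"
  shows "H k z s a = 3 / 2 * 4 ^ k * Lerch_moment 2 z s a
           + 3 / 2 * 2 ^ k * Lerch_moment 1 z s a + Lerch_moment 0 z s a"
proof -
  have "H_term k z s a = (\<lambda>r. 3 / 2 * 4 ^ k * Lerch_moment_term 2 z s a r
      + 3 / 2 * 2 ^ k * Lerch_moment_term 1 z s a r + Lerch_moment_term 0 z s a r)"
    by (auto simp: H_term_def Lerch_moment_term_def aug_centered_tri_def algebra_simps)
  moreover have "\<dots> sums (3 / 2 * 4 ^ k * Lerch_moment 2 z s a
           + 3 / 2 * 2 ^ k * Lerch_moment 1 z s a + Lerch_moment 0 z s a)"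
    using assms by (intro sums_add sums_mult Lerch_moment_sums) auto
  ultimately show ?thesis
    by (simp add: H_def sums_iff)
qed

lemma H_power_series_sums:
  fixes y :: complex
  assumes "norm z < 1 \<or> norm z = 1 \<and> Re s > 3" and y: "norm y < 1 / 4"
  shows "(\<lambda>k. H k z s a * y ^ k) sums
     (3 / 2 * Lerch_moment 2 z s a / (1 - 4 * y) + 3 / 2 * Lerch_moment 1 z s a / (1 - 2 * y)
       + Lerch_moment 0 z s a / (1 - y))"
proof -
  have geo: "(\<lambda>k. C * q ^ k) sums (C / (1 - q))" if "norm q < 1" for C q :: complex
    using sums_mult[OF geometric_sums[OF that], of C] by simp
  have "(\<lambda>k. H k z s a * y ^ k) = (\<lambda>k. 3 / 2 * Lerch_moment 2 z s a * (4 * y) ^ k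
      + 3 / 2 * Lerch_moment 1 z s a * (2 * y) ^ k + Lerch_moment 0 z s a * y ^ k)"
    using assms(1) by (auto simp: H_eq_Lerch_moments power_mult_distrib algebra_simps)
  then show ?thesis
    using y by (simp only:, intro sums_add geo) (auto simp: norm_mult)
qed

theorem theorem6p2:
  fixes a z s :: complex
  assumes a: "a \<notin> \<int>\<^sub>\<le>\<^sub>0"
  shows "((\<forall>k. summable (\<lambda>r. norm (H_term k z s a r))) \<longleftrightarrow>
            norm z < 1 \<or> norm z = 1 \<and> Re s > 3) \<and>
         ((\<forall>k. summable (\<lambda>r. norm (H_term k z s a r))) \<longrightarrow>
            (\<forall>y::complex. norm y < 1 / 4 \<longrightarrow>
               summable (\<lambda>k. H k z s a * y ^ k) \<and>
               G y z s a = 3 / 2 * D_Phi 2 z s a / (1 - 4 * y)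
                         + 3 / 2 * D_Phi 1 z s a / (1 - 2 * y)
                         + Lerch_Phi z s a / (1 - y) \<and>
               G y z s a =
                   3 / 2 * (Lerch_Phi z (s - 2) a - 2 * a * Lerch_Phi z (s - 1) a
                            + a\<^sup>2 * Lerch_Phi z s a) / (1 - 4 * y)
                 + 3 / 2 * (Lerch_Phi z (s - 1) a - a * Lerch_Phi z s a) / (1 - 2 * y)
                 + Lerch_Phi z s a / (1 - y)))"
proof (intro conjI impI allI)
  show "(\<forall>k. summable (\<lambda>r. norm (H_term k z s a r))) \<longleftrightarrow>
          norm z < 1 \<or> norm z = 1 \<and> Re s > 3"
    by (simp add: abs_summable_H_term_iff)
next
  fix y :: complex
  assume "\<forall>k. summable (\<lambda>r. norm (H_term k z s a r))" and y: "norm y < 1 / 4"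
  then have conv: "norm z < 1 \<or> norm z = 1 \<and> Re s > 3"
    by (simp add: abs_summable_H_term_iff)
  note sums = H_power_series_sums[OF conv y, of a]
  show "summable (\<lambda>k. H k z s a * y ^ k)"
    using sums by (rule sums_summable)
  have G: "G y z s a = 3 / 2 * Lerch_moment 2 z s a / (1 - 4 * y)
      + 3 / 2 * Lerch_moment 1 z s a / (1 - 2 * y) + Lerch_moment 0 z s a / (1 - y)"
    using sums by (simp add: G_def sums_iff)
  then show "G y z s a = 3 / 2 * D_Phi 2 z s a / (1 - 4 * y)
      + 3 / 2 * D_Phi 1 z s a / (1 - 2 * y) + Lerch_Phi z s a / (1 - y)"
    by (simp add: D_Phi_eq_Lerch_moment Lerch_Phi_eq_Lerch_moment)
  have M1: "Lerch_moment 1 z t a = Lerch_Phi z (t - 1) a - a * Lerch_Phi z t a"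
    if "norm z < 1 \<or> norm z = 1 \<and> Re t > 2" for t
    using Lerch_moment_Suc[OF a, of z 0 t] that by (simp add: Lerch_Phi_eq_Lerch_moment)
  have "Lerch_moment 2 z s a = Lerch_moment 1 z (s - 1) a - a * Lerch_moment 1 z s a"
    using Lerch_moment_Suc[OF a, of z 1 s] conv by (simp add: numeral_2_eq_2)
  also have "\<dots> = (Lerch_Phi z (s - 1 - 1) a - a * Lerch_Phi z (s - 1) a)
      - a * (Lerch_Phi z (s - 1) a - a * Lerch_Phi z s a)"
    using conv by (subst (1 2) M1) auto
  also have "\<dots> = Lerch_Phi z (s - 2) a - 2 * a * Lerch_Phi z (s - 1) a + a\<^sup>2 * Lerch_Phi z s a"
    by (simp add: algebra_simps power2_eq_square)
  finally have M2: "Lerch_moment 2 z s a =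
      Lerch_Phi z (s - 2) a - 2 * a * Lerch_Phi z (s - 1) a + a\<^sup>2 * Lerch_Phi z s a" .
  have "Lerch_moment 1 z s a = Lerch_Phi z (s - 1) a - a * Lerch_Phi z s a"
    using conv by (intro M1) auto
  with G M2 show "G y z s a =
      3 / 2 * (Lerch_Phi z (s - 2) a - 2 * a * Lerch_Phi z (s - 1) a
               + a\<^sup>2 * Lerch_Phi z s a) / (1 - 4 * y)
    + 3 / 2 * (Lerch_Phi z (s - 1) a - a * Lerch_Phi z s a) / (1 - 2 * y)
    + Lerch_Phi z s a / (1 - y)"
    by (simp add: Lerch_Phi_eq_Lerch_moment)
qed

end
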